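(* Let $X_1,X_2$ be vector subspaces of $\mathbb{R}^n$ with $X_1\cap X_2=\{0\}$ and let $\|\cdot\|$ be any norm on $\mathbb{R}^n$. Then there is a constant $C\ge1$ such that $\|h_1\|\le C\|h_1+h_2\|$ for all $h_1\in X_1$ and $h_2\in X_2$. *)

theory Defs
  imports "HOL-Analysis.Analysis"
begin

text \<open>
  The library's \<^const>\<open>norm\<close> is one fixed norm per type (the Euclidean one on
  \<^typ>\<open>real ^ 'n\<close>); the following predicate allows quantifying over all norms.
\<close>

definition is_norm :: "('a::real_vector \<Rightarrow> real) \<Rightarrow> bool" where
  "is_norm N \<longleftrightarrow>
     (\<forall>x. 0 \<le> N x) \<and>
     (\<forall>x. N x = 0 \<longleftrightarrow> x = 0) \<and>
     (\<forall>a x. N (a *\<^sub>R x) = \<bar>a\<bar> * N x) \<and>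
     (\<forall>x y. N (x + y) \<le> N x + N y)"

end

theory Submission
  imports Defs
begin

text \<open>
  Addition \<open>(h\<^sub>1, h\<^sub>2) \<mapsto> h\<^sub>1 + h\<^sub>2\<close> is injective on \<open>X\<^sub>1 \<times> X\<^sub>2\<close>, hence bounded below there for the
  Euclidean norm; equivalence of norms in finite dimension transfers the bound to \<open>N\<close>.
\<close>

text \<open>Expanding \<open>x\<close> in the orthonormal basis and applying the triangle inequality
  reduces the bound to the finitely many values of \<open>N\<close> on \<open>Basis\<close>, since
  each coordinate is at most \<open>norm x\<close> in absolute value.\<close>

lemma is_norm_le_norm:
  fixes N :: "'a::euclidean_space \<Rightarrow> real"
  assumes "is_norm N"
  shows "\<exists>B>0. \<forall>x. N x \<le> B * norm x"
proof -
  have tri: "N (x + y) \<le> N x + N y" and scale: "N (a *\<^sub>R x) = \<bar>a\<bar> * N x"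
    and nonneg: "0 \<le> N x" and zero: "N 0 = 0" for x y a
    using assms by (auto simp: is_norm_def)
  have sum_le: "N (\<Sum>i\<in>I. f i) \<le> (\<Sum>i\<in>I. N (f i))" if "finite I" for I :: "'a set" and f
    using that by (induction I rule: finite_induct) (auto simp: zero intro: order_trans[OF tri])
  \<comment> \<open>The summand 1 gives \<open>B > 0\<close> at once from nonnegativity of
    \<open>N\<close>.\<close>
  define B where "B = (\<Sum>b\<in>Basis. N b) + 1"
  have "B > 0"
    unfolding B_def by (intro add_nonneg_pos sum_nonneg nonneg) simp
  moreover have "N x \<le> B * norm x" for x
  proof -
    have "N x = N (\<Sum>b\<in>Basis. (x \<bullet> b) *\<^sub>R b)"
      by (simp add: euclidean_representation)
    also have "\<dots> \<le> (\<Sum>b\<in>Basis. \<bar>x \<bullet> b\<bar> * N b)"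
      using sum_le[OF finite_Basis, of "\<lambda>b. (x \<bullet> b) *\<^sub>R b"] by (simp add: scale)
    also have "\<dots> \<le> (\<Sum>b\<in>Basis. norm x * N b)"
      by (intro sum_mono mult_right_mono Basis_le_norm nonneg)
    also have "\<dots> \<le> B * norm x"
      by (simp add: B_def sum_distrib_left algebra_simps)
    finally show ?thesis .
  qed
  ultimately show ?thesis by blast
qed

text \<open>By compactness \<open>N\<close> attains a minimum on the Euclidean unit sphere; it is
  positive by definiteness, and homogeneity carries the bound to all vectors.\<close>

lemma norm_le_is_norm:
  fixes N :: "'a::euclidean_space \<Rightarrow> real"
  assumes "is_norm N"
  shows "\<exists>K>0. \<forall>x. norm x \<le> K * N x"
proof -
  have tri: "N (x + y) \<le> N x + N y" and scale: "N (a *\<^sub>R x) = \<bar>a\<bar> * N x"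
    and nonneg: "0 \<le> N x" and zero: "N x = 0 \<longleftrightarrow> x = 0" for x y a
    using assms by (auto simp: is_norm_def)
  obtain B where B: "B > 0" "\<And>x. N x \<le> B * norm x"
    using is_norm_le_norm[OF assms] by blast
  \<comment> \<open>Reverse triangle inequality combined with the upper bound: this makes
    \<open>N\<close> Lipschitz, hence continuous, for the Euclidean topology.\<close>
  have diff: "N x - N y \<le> B * norm (x - y)" for x y
    using tri[of "x - y" y] B(2)[of "x - y"] by simp
  have "\<bar>N x - N y\<bar> \<le> B * dist x y" for x y
    using diff[of x y] diff[of y x] by (simp add: dist_norm norm_minus_commute abs_le_iff)
  then have "B-lipschitz_on (sphere 0 1) N"
    using B(1) by (intro lipschitz_onI) (auto simp: dist_real_def)
  then have "continuous_on (sphere 0 1) N"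
    by (rule lipschitz_on_continuous_on)
  then obtain u where u: "u \<in> sphere 0 1" "\<And>x. x \<in> sphere 0 1 \<Longrightarrow> N u \<le> N x"
    using continuous_attains_inf[of "sphere 0 1" N] by auto
  have "N u > 0"
    using u(1) zero[of u] nonneg[of u] by (auto simp: less_le)
  have "N u * norm x \<le> N x" for x
  proof (cases "x = 0")
    case False
    then have "N u \<le> N ((1 / norm x) *\<^sub>R x)"
      by (intro u(2)) simp
    also have "\<dots> = N x / norm x"
      using scale[of "1 / norm x" x] by simp
    finally show ?thesis
      using False by (simp add: field_simps)
  qed (simp add: nonneg)
  then have "norm x \<le> (1 / N u) * N x" for x
    using \<open>N u > 0\<close> by (simp add: field_simps)
  then show ?thesis
    using \<open>N u > 0\<close> by (intro exI[of _ "1 / N u"]) auto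
qed

text \<open>An injective linear map on a closed subspace in finite dimension is bounded below; here
  the map is addition on \<open>X \<times> Y\<close>.\<close>

lemma norm_le_norm_add_subspaces:
  fixes X Y :: "'a::euclidean_space set"
  assumes "subspace X" "subspace Y" "X \<inter> Y = {0}"
  shows "\<exists>e>0. \<forall>x\<in>X. \<forall>y\<in>Y. e * norm x \<le> norm (x + y)"
proof -
  have sub: "subspace (X \<times> Y)"
    using assms by (simp add: subspace_Times)
  have lin: "bounded_linear (\<lambda>p::'a \<times> 'a. fst p + snd p)"
    by (intro bounded_linear_add bounded_linear_fst bounded_linear_snd)
  \<comment> \<open>Trivial kernel: if the components of \<open>p\<close> sum to zero, each is the
    negative of the other, so both lie in the intersection.\<close>
  have "p = 0" if "p \<in> X \<times> Y" "fst p + snd p = 0" for p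
  proof -
    have "fst p = - snd p"
      using that(2) by (simp add: eq_neg_iff_add_eq_0)
    moreover from this have "fst p \<in> X \<inter> Y"
      using that(1) subspace_neg[OF assms(2), of "snd p"] by auto
    ultimately show ?thesis
      using assms(3) by (auto simp: prod_eq_iff)
  qed
  then obtain e where e: "e > 0" "\<forall>p\<in>X \<times> Y. norm (fst p + snd p) \<ge> e * norm p"
    using injective_imp_isometric[OF closed_subspace[OF sub] sub lin] by blast
  have "e * norm x \<le> norm (x + y)" if "x \<in> X" "y \<in> Y" for x y
  proof -
    have "e * norm x \<le> e * norm (x, y)"
      using e(1) norm_fst_le[of x y] by simp
    also have "\<dots> \<le> norm (x + y)"
      using e(2) that by force
    finally show ?thesis .
  qed
  with e(1) show ?thesis by blast
qed

theorem lemmaA2: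
  fixes X\<^sub>1 X\<^sub>2 :: "(real ^ 'n) set"
    and N :: "real ^ 'n \<Rightarrow> real"
  assumes "subspace X\<^sub>1" and "subspace X\<^sub>2"
    and "X\<^sub>1 \<inter> X\<^sub>2 = {0}"
    and "is_norm N"
  shows "\<exists>C\<ge>1. \<forall>h\<^sub>1\<in>X\<^sub>1. \<forall>h\<^sub>2\<in>X\<^sub>2. N h\<^sub>1 \<le> C * N (h\<^sub>1 + h\<^sub>2)"
proof -
  obtain B where B: "B > 0" "\<And>x. N x \<le> B * norm x"
    using is_norm_le_norm[OF assms(4)] by blast
  obtain K where K: "K > 0" "\<And>x. norm x \<le> K * N x"
    using norm_le_is_norm[OF assms(4)] by blast
  obtain e where e: "e > 0" "\<And>x y. x \<in> X\<^sub>1 \<Longrightarrow> y \<in> X\<^sub>2 \<Longrightarrow> e * norm x \<le> norm (x + y)"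
    using norm_le_norm_add_subspaces[OF assms(1-3)] by blast
  \<comment> \<open>The factors are collected from the chain \<open>N\<close> to Euclidean norm
    (\<open>B\<close>), splitting off the summand (\<open>1 / e\<close>), and back to
    \<open>N\<close> (\<open>K\<close>); the maximum ensures \<open>C \<ge> 1\<close>.\<close>
  define C where "C = max 1 (B / e * K)"
  have "N x \<le> C * N (x + y)" if "x \<in> X\<^sub>1" "y \<in> X\<^sub>2" for x y
  proof -
    have "N x \<le> B * norm x"
      by (rule B(2))
    also have "\<dots> = B / e * (e * norm x)"
      using e(1) by simp
    also have "\<dots> \<le> B / e * (K * N (x + y))"
      using B(1) e(1) order_trans[OF e(2)[OF that] K(2)] by (intro mult_left_mono) auto
    also have "\<dots> \<le> C * N (x + y)"
      using assms(4) unfolding mult.assoc[symmetric] C_def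
      by (intro mult_right_mono) (auto simp: is_norm_def)
    finally show ?thesis .
  qed
  then show ?thesis
    by (intro exI[of _ C]) (auto simp: C_def)
qed

end
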